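(* Let $k\geq 2$ be an integer. Every countable graph, and every countable acyclic digraph, is $(1/k)$-majority $(k+1)$-correspondence colourable: for every assignment of lists $L(v)$ of exactly $k+1$ colours to the vertices and every assignment of bad sets $B_{uv}$ to the edges (arcs) satisfying the correspondence condition, there is a colouring $\chi$ with $\chi(v)\in L(v)$ for all $v$ which is a $(1/k)$-majority correspondence colouring.
   Context: Given a graph $G$, each vertex $v$ has a list $L(v)$ of colours and each edge $uv$ has a set of bad pairs $B_{uv}\subset L(u)\times L(v)$ such that for each $c\in L(u)$ there is at most one pair $(c,c')\in B_{uv}$ and for each $c\in L(v)$ there is at most one pair $(c',c)\in B_{uv}$ (with $B_{vu}$ the corresponding set of reversed pairs). For a digraph, each arc $u\to v$ carries such a set $B_{uv}$. For a colouring $\chi$ with $\chi(v)\in L(v)$, an edge/arc $uv$ is bad if $(\chi(u),\chi(v))\in B_{uv}$. The relevant edges at $v$ are all edges incident with $v$ in the graph case, and the out-arcs of $v$ in the digraph case. $\chi$ is a $(1/k)$-majority correspondence colouring if for every vertex $v$: if $v$ has finitely many relevant edges, at most a $1/k$ proportion of them are bad; if $v$ has infinitely many relevant edges, infinitely many of them are not bad. A graph/digraph is $(1/k)$-majority $\ell$-correspondence colourable if for every such system of lists of size $\ell$ and bad sets there is a $(1/k)$-majority correspondence colouring. An acyclic digraph has no directed cycle. *)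

theory Defs
  imports Complex_Main "HOL-Library.Countable_Set"
begin

text \<open>
  A simple graph is a symmetric irreflexive relation \<open>E\<close> on \<open>V\<close>: the edge \<open>uv\<close> is represented by
  the two pairs \<open>(u, v)\<close> and \<open>(v, u)\<close>. A digraph is an arbitrary relation on \<open>V\<close>, where \<open>(u, v)\<close>
  is the arc from \<open>u\<close> to \<open>v\<close>.
\<close>

definition graph :: "'v set \<Rightarrow> 'v rel \<Rightarrow> bool" where
  "graph V E \<longleftrightarrow> E \<subseteq> V \<times> V \<and> sym E \<and> irrefl E"

definition digraph :: "'v set \<Rightarrow> 'v rel \<Rightarrow> bool" where
  "digraph V E \<longleftrightarrow> E \<subseteq> V \<times> V"

definition correspondence :: "'c set \<Rightarrow> 'c set \<Rightarrow> ('c \<times> 'c) set \<Rightarrow> bool" where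
  "correspondence X Y M \<longleftrightarrow> M \<subseteq> X \<times> Y \<and>
     (\<forall>c\<in>X. \<exists>\<^sub>\<le>\<^sub>1 c'. (c, c') \<in> M) \<and> (\<forall>c\<in>Y. \<exists>\<^sub>\<le>\<^sub>1 c'. (c', c) \<in> M)"

definition digraph_system ::
  "nat \<Rightarrow> 'v set \<Rightarrow> 'v rel \<Rightarrow> ('v \<Rightarrow> 'c set) \<Rightarrow> ('v \<Rightarrow> 'v \<Rightarrow> ('c \<times> 'c) set) \<Rightarrow> bool" where
  "digraph_system l V E L B \<longleftrightarrow>
     (\<forall>v\<in>V. finite (L v) \<and> card (L v) = l) \<and>
     (\<forall>(u, v)\<in>E. correspondence (L u) (L v) (B u v))"

definition graph_system ::
  "nat \<Rightarrow> 'v set \<Rightarrow> 'v rel \<Rightarrow> ('v \<Rightarrow> 'c set) \<Rightarrow> ('v \<Rightarrow> 'v \<Rightarrow> ('c \<times> 'c) set) \<Rightarrow> bool" where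
  "graph_system l V E L B \<longleftrightarrow>
     digraph_system l V E L B \<and> (\<forall>(u, v)\<in>E. B v u = (B u v)\<inverse>)"

text \<open>
  For a digraph these are the out-arcs of \<open>v\<close>. For a graph they are all the edges incident with \<open>v\<close>,
  each represented exactly once, by the pair whose first component is \<open>v\<close>.
\<close>

definition relevant_edges :: "'v rel \<Rightarrow> 'v \<Rightarrow> ('v \<times> 'v) set" where
  "relevant_edges E v = {e \<in> E. fst e = v}"

definition bad :: "('v \<Rightarrow> 'v \<Rightarrow> ('c \<times> 'c) set) \<Rightarrow> ('v \<Rightarrow> 'c) \<Rightarrow> 'v \<times> 'v \<Rightarrow> bool" where
  "bad B \<chi> = (\<lambda>(u, v). (\<chi> u, \<chi> v) \<in> B u v)"

definition majority_correspondence_colouring ::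
  "nat \<Rightarrow> 'v set \<Rightarrow> 'v rel \<Rightarrow> ('v \<Rightarrow> 'c set) \<Rightarrow> ('v \<Rightarrow> 'v \<Rightarrow> ('c \<times> 'c) set) \<Rightarrow> ('v \<Rightarrow> 'c) \<Rightarrow> bool" where
  "majority_correspondence_colouring k V E L B \<chi> \<longleftrightarrow>
     (\<forall>v\<in>V. \<chi> v \<in> L v) \<and>
     (\<forall>v\<in>V.
        if finite (relevant_edges E v)
        then real (card {e \<in> relevant_edges E v. bad B \<chi> e})
               \<le> 1 / real k * real (card (relevant_edges E v))
        else infinite {e \<in> relevant_edges E v. \<not> bad B \<chi> e})"

text \<open>The argument of type \<open>'c itself\<close> only fixes the type the colours are taken from.\<close>

definition graph_majority_correspondence_colourable ::
  "'c itself \<Rightarrow> nat \<Rightarrow> nat \<Rightarrow> 'v set \<Rightarrow> 'v rel \<Rightarrow> bool" where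
  "graph_majority_correspondence_colourable _ k l V E \<longleftrightarrow>
     (\<forall>(L :: 'v \<Rightarrow> 'c set) B. graph_system l V E L B \<longrightarrow>
        (\<exists>\<chi>. majority_correspondence_colouring k V E L B \<chi>))"

definition digraph_majority_correspondence_colourable ::
  "'c itself \<Rightarrow> nat \<Rightarrow> nat \<Rightarrow> 'v set \<Rightarrow> 'v rel \<Rightarrow> bool" where
  "digraph_majority_correspondence_colourable _ k l V E \<longleftrightarrow>
     (\<forall>(L :: 'v \<Rightarrow> 'c set) B. digraph_system l V E L B \<longrightarrow>
        (\<exists>\<chi>. majority_correspondence_colouring k V E L B \<chi>))"

end

theory Submission
  imports Defs
begin

text \<open>
  Delete one colour from every list so that, whatever colour \<open>c\<close> a vertex \<open>v\<close> with infinitely many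
  relevant edges receives, infinitely many of its neighbours have lost their unique colour in
  conflict with \<open>c\<close>. This is possible since there are only countably many pairs \<open>(v, c)\<close> to serve,
  each infinitely often, and each request can be met at a neighbour not used before.
  Vertices with infinitely many relevant edges are then satisfied by every colouring from the
  remaining lists, which still have \<open>k\<close> colours. For finitely many vertices with finitely many
  relevant edges, averaging over \<open>k\<close> colours recolours any single vertex well: in a graph, a
  colouring with the fewest bad edges works, and in an acyclic digraph one colours each vertex after
  its out-neighbours. Compactness concludes.
\<close>

section \<open>Serving countably many requests infinitely often\<close>

lemma infinitely_often_enumeration:
  assumes "countable T" "T \<noteq> {}"
  obtains s :: "nat \<Rightarrow> 'a" where "range s \<subseteq> T" "\<And>t. t \<in> T \<Longrightarrow> infinite {n. s n = t}"
proof -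
  \<comment> \<open>The second component of the decoded pair is a free counter, so each
    \<open>t\<close> recurs at all codes of pairs \<open>(to_nat_on T t, m)\<close>.\<close>
  define s where "s n = from_nat_into T (fst (prod_decode n))" for n
  have "infinite {n. s n = t}" if "t \<in> T" for t
  proof -
    have "range (\<lambda>m. prod_encode (to_nat_on T t, m)) \<subseteq> {n. s n = t}"
      using that assms by (auto simp: s_def)
    moreover have "inj (\<lambda>m. prod_encode (to_nat_on T t, m))"
      by (auto simp: inj_on_def)
    ultimately show ?thesis
      using finite_subset range_inj_infinite by blast
  qed
  moreover have "range s \<subseteq> T"
    using assms unfolding s_def by (blast intro: from_nat_into)
  ultimately show thesis
    using that by blast
qed

lemma infinitely_often_prescribed_values:
  fixes g :: "'t \<Rightarrow> 'v \<Rightarrow> 'c"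
  assumes "countable T" and inf: "\<And>t. t \<in> T \<Longrightarrow> infinite (N t)"
  shows "\<exists>d. \<forall>t\<in>T. infinite {u \<in> N t. d u = g t u}"
proof (cases "T = {}")
  case False
  obtain s :: "nat \<Rightarrow> 't" where s: "range s \<subseteq> T" "\<And>t. t \<in> T \<Longrightarrow> infinite {n. s n = t}"
    using infinitely_often_enumeration[OF assms(1) False] by metis
  have "\<exists>h. \<forall>n. h n \<in> N (s n) - h ` {..<n}"
  proof (rule dependent_wellorder_choice)
    show "(r \<in> N (s x) - f ` {..<x}) = (r \<in> N (s x) - g ` {..<x})"
      if "\<And>y. y < x \<Longrightarrow> f y = g y" for r f g and x :: nat
      using that by (auto simp: image_iff)
    show "\<exists>r. r \<in> N (s x) - f ` {..<x}" for x and f :: "nat \<Rightarrow> 'v"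
    proof -
      have "infinite (N (s x) - f ` {..<x})"
        using inf s(1) by (intro Diff_infinite_finite) auto
      then show ?thesis
        using infinite_imp_nonempty by blast
    qed
  qed
  then obtain h where h: "\<And>n. h n \<in> N (s n)" "\<And>n m. m < n \<Longrightarrow> h n \<noteq> h m"
    by blast
  have inj: "inj h"
    by (rule injI) (metis h(2) linorder_neqE_nat)
  \<comment> \<open>Outside the range of \<open>h\<close> the inverse is arbitrary; the value of
    \<open>d\<close> there is irrelevant.\<close>
  define d where "d u = g (s (inv h u)) u" for u
  have "infinite {u \<in> N t. d u = g t u}" if "t \<in> T" for t
  proof -
    have "infinite (h ` {n. s n = t})"
      using s(2)[OF that] inj by (meson finite_imageD inj_on_subset subset_UNIV)
    moreover have "h ` {n. s n = t} \<subseteq> {u \<in> N t. d u = g t u}"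
      using h(1) inj by (auto simp: d_def)
    ultimately show ?thesis
      using finite_subset by blast
  qed
  then show ?thesis
    by blast
qed auto

section \<open>Compactness for colourings from finite lists\<close>

lemma countable_colouring_compactness:
  fixes P :: "'i \<Rightarrow> ('v \<Rightarrow> 'c) \<Rightarrow> bool"
  assumes "countable V" and fin_L: "\<And>v. v \<in> V \<Longrightarrow> finite (L v)"
    and D: "\<And>i. i \<in> S \<Longrightarrow> finite (D i)" "\<And>i. i \<in> S \<Longrightarrow> D i \<subseteq> V"
    and local: "\<And>i \<chi> \<chi>'. i \<in> S \<Longrightarrow> (\<And>u. u \<in> D i \<Longrightarrow> \<chi> u = \<chi>' u) \<Longrightarrow> P i \<chi> \<Longrightarrow> P i \<chi>'"
    and fin_sat: "\<And>F. finite F \<Longrightarrow> F \<subseteq> S \<Longrightarrow> \<exists>\<chi>. (\<forall>v\<in>V. \<chi> v \<in> L v) \<and> (\<forall>i\<in>F. P i \<chi>)"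
  shows "\<exists>\<chi>. (\<forall>v\<in>V. \<chi> v \<in> L v) \<and> (\<forall>i\<in>S. P i \<chi>)"
proof (cases "V = {}")
  case True
  \<comment> \<open>Here \<open>D i\<close> is empty, so the truth of \<open>P i\<close> does not
    depend on the colouring.\<close>
  have "P i \<chi>" if "i \<in> S" for i \<chi>
    using fin_sat[of "{i}"] local[OF that, of _ \<chi>] D(2)[OF that] that True by auto
  with True show ?thesis
    by auto
next
  case False
  define e where "e = from_nat_into V"
  have e: "e n \<in> V" for n
    using False by (simp add: e_def from_nat_into)
  define sat where "sat F \<chi> \<longleftrightarrow> (\<forall>v\<in>V. \<chi> v \<in> L v) \<and> (\<forall>i\<in>F. P i \<chi>)" for F \<chi>
  \<comment> \<open>The invariant of a Koenig-style construction: after fixing \<open>f\<close>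
    below \<open>n\<close>, the choice \<open>r\<close> at \<open>e n\<close> leaves every finite
    set of constraints satisfiable. Repetitions in \<open>e\<close> are harmless, since a single
    colouring realises all the values and so forces them to agree.\<close>
  define Q where "Q f n r \<longleftrightarrow> (\<forall>F. finite F \<longrightarrow> F \<subseteq> S \<longrightarrow>
      (\<exists>\<chi>. sat F \<chi> \<and> (\<forall>m<n. \<chi> (e m) = f m) \<and> \<chi> (e n) = r))" for f n r
  have "\<exists>f. \<forall>n. Q f n (f n)"
  proof (rule dependent_wellorder_choice)
    show "Q f n r = Q g n r" if "\<And>y. y < n \<Longrightarrow> f y = g y" for r f g and n :: nat
      using that by (auto simp: Q_def)
    show "\<exists>r. Q f n r" if IH: "\<And>m. m < n \<Longrightarrow> Q f m (f m)" for n f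
    proof (rule ccontr)
      assume contra: "\<nexists>r. Q f n r"
      have ext: "\<exists>\<chi>. sat F \<chi> \<and> (\<forall>m<n. \<chi> (e m) = f m)" if F: "finite F" "F \<subseteq> S" for F
      proof (cases n)
        case 0
        then show ?thesis
          using fin_sat[OF F] by (auto simp: sat_def)
      next
        case (Suc m)
        then obtain \<chi> where "sat F \<chi>" "\<forall>m'<m. \<chi> (e m') = f m'" "\<chi> (e m) = f m"
          using IH[of m] F unfolding Q_def by (metis lessI)
        then show ?thesis
          using Suc by (auto simp: less_Suc_eq)
      qed
      \<comment> \<open>Each value \<open>r\<close> is refuted by a finite set \<open>F r\<close>.
        The union over the finite list at \<open>e n\<close> is finite, so it has a solution
        extending \<open>f\<close>, whose colour at \<open>e n\<close> was supposedly
        refuted.\<close>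
      from contra obtain F where F: "\<And>r. finite (F r) \<and> F r \<subseteq> S \<and>
          \<not> (\<exists>\<chi>. sat (F r) \<chi> \<and> (\<forall>m<n. \<chi> (e m) = f m) \<and> \<chi> (e n) = r)"
        unfolding Q_def by metis
      have "finite (\<Union>r\<in>L (e n). F r)" "(\<Union>r\<in>L (e n). F r) \<subseteq> S"
        using F fin_L[OF e] by blast+
      from ext[OF this] obtain \<chi>
        where \<chi>: "sat (\<Union>r\<in>L (e n). F r) \<chi>" "\<forall>m<n. \<chi> (e m) = f m"
        by blast
      have "\<chi> (e n) \<in> L (e n)"
        using \<chi>(1) e by (auto simp: sat_def)
      then have "sat (F (\<chi> (e n))) \<chi>"
        using \<chi>(1) by (auto simp: sat_def)
      then show False
        using F \<chi>(2) by blast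
    qed
  qed
  then obtain f where f: "\<And>n. Q f n (f n)"
    by blast
  define \<chi> where "\<chi> v = f (to_nat_on V v)" for v
  have approx: "\<exists>\<chi>'. sat F \<chi>' \<and> (\<forall>v\<in>A. \<chi>' v = \<chi> v)"
    if F: "finite F" "F \<subseteq> S" and "finite A" "A \<subseteq> V" for F A
  proof -
    obtain n where n: "\<forall>m\<in>to_nat_on V ` A. m < n"
      using \<open>finite A\<close> finite_nat_set_iff_bounded by blast
    obtain \<chi>' where \<chi>': "sat F \<chi>'" "\<forall>m<n. \<chi>' (e m) = f m"
      using f[of n] F unfolding Q_def by blast
    have "\<chi>' v = \<chi> v" if "v \<in> A" for v
    proof -
      have "e (to_nat_on V v) = v"
        using that \<open>A \<subseteq> V\<close> \<open>countable V\<close> by (auto simp: e_def)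
      then show ?thesis
        using \<chi>'(2) n that by (metis \<chi>_def imageI)
    qed
    then show ?thesis
      using \<chi>'(1) by blast
  qed
  have "\<chi> v \<in> L v" if "v \<in> V" for v
    using approx[of "{}" "{v}"] that by (auto simp: sat_def)
  moreover have "P i \<chi>" if "i \<in> S" for i
  proof -
    obtain \<chi>' where "P i \<chi>'" "\<forall>v\<in>D i. \<chi>' v = \<chi> v"
      using approx[of "{i}" "D i"] D \<open>i \<in> S\<close> by (auto simp: sat_def)
    then show ?thesis
      using local[OF that, of \<chi>' \<chi>] by blast
  qed
  ultimately show ?thesis
    by blast
qed

section \<open>Recolouring one vertex, and finite sets of vertices of finite degree\<close>

lemma exists_colour_few_conflicts:
  assumes "finite A" "finite N" "k \<le> card A" "0 < k"
    and unique: "\<And>x c c'. x \<in> N \<Longrightarrow> c \<in> A \<Longrightarrow> c' \<in> A \<Longrightarrow> R c x \<Longrightarrow> R c' x \<Longrightarrow> c = c'"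
  shows "\<exists>c\<in>A. k * card {x \<in> N. R c x} \<le> card N"
proof (rule ccontr)
  assume "\<not> ?thesis"
  then have "card N + 1 \<le> k * card {x \<in> N. R c x}" if "c \<in> A" for c
    using that by force
  then have "(\<Sum>c\<in>A. card N + 1) \<le> (\<Sum>c\<in>A. k * card {x \<in> N. R c x})"
    by (rule sum_mono)
  \<comment> \<open>By \<open>unique\<close>, the conflict sets of distinct colours are disjoint, so
    their sizes add up to at most \<open>card N\<close>.\<close>
  also have "\<dots> = k * card (\<Union>c\<in>A. {x \<in> N. R c x})"
    unfolding sum_distrib_left[symmetric] using assms(1,2) unique
    by (subst card_UN_disjoint) auto
  also have "\<dots> \<le> k * card N"
    using assms(2) by (intro mult_left_mono card_mono) auto
  also have "\<dots> < k * (card N + 1)"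
    using \<open>0 < k\<close> by simp
  also have "\<dots> \<le> (\<Sum>c\<in>A. card N + 1)"
    using \<open>k \<le> card A\<close> by (simp only: sum_constant of_nat_id mult_le_mono1)
  finally show False
    by simp
qed

text \<open>The majority condition for finite degree, multiplied out by \<open>k\<close> to stay
  within the natural numbers.\<close>

definition few_bad_edges ::
  "nat \<Rightarrow> 'v rel \<Rightarrow> ('v \<Rightarrow> 'v \<Rightarrow> ('c \<times> 'c) set) \<Rightarrow> ('v \<Rightarrow> 'c) \<Rightarrow> 'v \<Rightarrow> bool" where
  "few_bad_edges k E B \<chi> v \<longleftrightarrow>
     k * card {e \<in> relevant_edges E v. bad B \<chi> e} \<le> card (relevant_edges E v)"

lemma few_bad_edges_cong:
  assumes "\<And>u. u \<in> insert v (E `` {v}) \<Longrightarrow> \<chi> u = \<chi>' u"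
  shows "few_bad_edges k E B \<chi> v \<longleftrightarrow> few_bad_edges k E B \<chi>' v"
proof -
  have "{e \<in> relevant_edges E v. bad B \<chi> e} = {e \<in> relevant_edges E v. bad B \<chi>' e}"
    using assms by (auto simp: relevant_edges_def bad_def)
  then show ?thesis
    by (simp add: few_bad_edges_def)
qed

lemma correspondence_left_unique:
  assumes "correspondence X Y M" "(c, d) \<in> M" "(c', d) \<in> M"
  shows "c = c'"
  using assms unfolding correspondence_def Uniq_def by blast

lemma correspondence_right_unique:
  assumes "correspondence X Y M" "(c, d) \<in> M" "(c, d') \<in> M"
  shows "d = d'"
  using assms unfolding correspondence_def Uniq_def by blast

text \<open>Without a loop at \<open>v\<close>, recolouring \<open>v\<close> leaves the other end of
  each relevant edge unchanged. The correspondence condition then makes each such edge bad for at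
  most one choice of \<open>c\<close>, so averaging applies.\<close>

lemma exists_recolouring_few_bad_edges:
  assumes "digraph_system l V E L B" "(v, v) \<notin> E" "finite (relevant_edges E v)"
    and "finite A" "k \<le> card A" "0 < k"
  shows "\<exists>c\<in>A. few_bad_edges k E B (\<chi>(v := c)) v"
proof -
  have "\<exists>c\<in>A. k * card {e \<in> relevant_edges E v. bad B (\<chi>(v := c)) e} \<le> card (relevant_edges E v)"
  proof (rule exists_colour_few_conflicts)
    fix x c c'
    assume x: "x \<in> relevant_edges E v" and "bad B (\<chi>(v := c)) x" "bad B (\<chi>(v := c')) x"
    moreover obtain u where u: "x = (v, u)" "(v, u) \<in> E"
      using x by (cases x) (auto simp: relevant_edges_def)
    ultimately have "(c, \<chi> u) \<in> B v u" "(c', \<chi> u) \<in> B v u"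
      using assms(2) by (auto simp: bad_def split: if_splits)
    moreover have "correspondence (L v) (L u) (B v u)"
      using assms(1) u(2) by (auto simp: digraph_system_def)
    ultimately show "c = c'"
      using correspondence_left_unique by metis
  qed (use assms in auto)
  then show ?thesis
    by (simp add: few_bad_edges_def)
qed

text \<open>Induction on the size of \<open>F\<close>: a vertex \<open>v\<close> of \<open>F\<close>
  without in-neighbours in \<open>F\<close> is recoloured last, which affects no out-arc of the rest
  of \<open>F\<close>.\<close>

lemma acyclic_digraph_finitely_satisfiable:
  assumes "digraph_system l V E L B" "acyclic E" "0 < k"
    and L': "\<And>v. v \<in> V \<Longrightarrow> finite (L' v)" "\<And>v. v \<in> V \<Longrightarrow> k \<le> card (L' v)"
    and "finite F" "F \<subseteq> {v \<in> V. finite (relevant_edges E v)}"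
  shows "\<exists>\<chi>. (\<forall>v\<in>V. \<chi> v \<in> L' v) \<and> (\<forall>v\<in>F. few_bad_edges k E B \<chi> v)"
  using assms(6,7)
proof (induction "card F" arbitrary: F)
  case 0
  have "\<forall>v\<in>V. \<exists>c. c \<in> L' v"
    using L'(2) \<open>0 < k\<close> by (metis card.empty ex_in_conv leD)
  then obtain \<chi> where "\<forall>v\<in>V. \<chi> v \<in> L' v"
    by metis
  with 0 show ?case
    by auto
next
  case (Suc n)
  have irrefl: "(v, v) \<notin> E" for v
    using \<open>acyclic E\<close> by (auto simp: acyclic_def)
  \<comment> \<open>An infinite acyclic \<open>E\<close> need not be well-founded, but its
    restriction to the finite set \<open>F\<close> is; a minimal element is the required
    source.\<close>
  have "wf (Restr E F)"
    using Suc.prems(1) \<open>acyclic E\<close> by (intro finite_acyclic_wf) (auto intro: acyclic_subset)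
  moreover obtain w where "w \<in> F"
    using Suc.hyps(2) by fastforce
  ultimately obtain v where v: "v \<in> F" "\<And>u. (u, v) \<in> Restr E F \<Longrightarrow> u \<notin> F"
    by (rule wfE_min) blast
  have "n = card (F - {v})"
    using Suc.hyps(2) Suc.prems(1) v(1) by simp
  then obtain \<chi> where \<chi>: "\<forall>v\<in>V. \<chi> v \<in> L' v" "\<forall>u\<in>F - {v}. few_bad_edges k E B \<chi> u"
    using Suc.hyps(1)[of "F - {v}"] Suc.prems by blast
  have "v \<in> V" "finite (relevant_edges E v)"
    using Suc.prems(2) v(1) by auto
  then obtain c where c: "c \<in> L' v" "few_bad_edges k E B (\<chi>(v := c)) v"
    using exists_recolouring_few_bad_edges[OF assms(1) irrefl] L' \<open>0 < k\<close> by blast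
  have "few_bad_edges k E B (\<chi>(v := c)) u" if "u \<in> F" for u
  proof (cases "u = v")
    case False
    then have "few_bad_edges k E B \<chi> u"
      using \<chi>(2) that by auto
    moreover have "v \<notin> insert u (E `` {u})"
      using v(1) v(2)[of u] that False by blast
    then have "few_bad_edges k E B \<chi> u \<longleftrightarrow> few_bad_edges k E B (\<chi>(v := c)) u"
      by (intro few_bad_edges_cong) auto
    ultimately show ?thesis
      by blast
  qed (use c in auto)
  moreover have "\<forall>u\<in>V. (\<chi>(v := c)) u \<in> L' u"
    using \<chi>(1) c(1) by auto
  ultimately show ?case
    by blast
qed

text \<open>In a colouring with the fewest bad edges meeting \<open>F\<close>, no recolouring of a
  vertex of \<open>F\<close> lowers the number of bad edges there, in particular not the good
  recolouring found by averaging.\<close>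

lemma graph_finitely_satisfiable:
  assumes "graph V E" "graph_system l V E L B" "0 < k"
    and L': "\<And>v. v \<in> V \<Longrightarrow> finite (L' v)" "\<And>v. v \<in> V \<Longrightarrow> k \<le> card (L' v)"
    and "finite F" "F \<subseteq> {v \<in> V. finite (relevant_edges E v)}"
  shows "\<exists>\<chi>. (\<forall>v\<in>V. \<chi> v \<in> L' v) \<and> (\<forall>v\<in>F. few_bad_edges k E B \<chi> v)"
proof -
  have sym: "(v, u) \<in> E" if "(u, v) \<in> E" for u v
    using that assms(1) by (auto simp: graph_def sym_def)
  have irrefl: "(v, v) \<notin> E" for v
    using assms(1) by (auto simp: graph_def irrefl_def)
  have B_conv: "B v u = (B u v)\<inverse>" if "(u, v) \<in> E" for u v
    using that assms(2) by (auto simp: graph_system_def)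
  have "\<forall>v\<in>V. \<exists>c. c \<in> L' v"
    using L'(2) \<open>0 < k\<close> by (metis card.empty ex_in_conv leD)
  then obtain \<chi>\<^sub>0 where \<chi>\<^sub>0: "\<forall>v\<in>V. \<chi>\<^sub>0 v \<in> L' v"
    by metis
  \<comment> \<open>Only edges meeting \<open>F\<close> are counted, which keeps the count finite;
    both orientations are included.\<close>
  define X where "X = (\<Union>v\<in>F. relevant_edges E v \<union> (relevant_edges E v)\<inverse>)"
  have "finite X"
    using assms(6,7) by (auto simp: X_def)
  define m where "m \<chi> = card {e \<in> X. bad B \<chi> e}" for \<chi>
  obtain \<chi> where \<chi>: "\<forall>v\<in>V. \<chi> v \<in> L' v" "\<And>\<chi>'. \<forall>v\<in>V. \<chi>' v \<in> L' v \<Longrightarrow> m \<chi> \<le> m \<chi>'"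
    using ex_has_least_nat[of "\<lambda>\<chi>. \<forall>v\<in>V. \<chi> v \<in> L' v" \<chi>\<^sub>0 m] \<chi>\<^sub>0 by blast
  have "few_bad_edges k E B \<chi> v" if "v \<in> F" for v
  proof -
    have "v \<in> V" and fin: "finite (relevant_edges E v)"
      using assms(7) that by auto
    then obtain c where c: "c \<in> L' v" "few_bad_edges k E B (\<chi>(v := c)) v"
      using exists_recolouring_few_bad_edges[of l V E L B v "L' v" k \<chi>] assms(2,3) L' irrefl
      unfolding graph_system_def by blast
    define R where "R = X - (relevant_edges E v \<union> (relevant_edges E v)\<inverse>)"
    \<comment> \<open>Each edge at \<open>v\<close> lies in \<open>X\<close> in both orientations,
      and by \<open>B_conv\<close> these are bad together; hence the factor 2. The pairs in
      \<open>R\<close> avoid \<open>v\<close>, so recolouring \<open>v\<close> does not affect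
      them.\<close>
    have split: "m \<psi> = 2 * card {e \<in> relevant_edges E v. bad B \<psi> e} + card {e \<in> R. bad B \<psi> e}"
      for \<psi>
    proof -
      let ?A = "{e \<in> relevant_edges E v. bad B \<psi> e}"
      have "{e \<in> X. bad B \<psi> e} = ?A \<union> ?A\<inverse> \<union> {e \<in> R. bad B \<psi> e}"
        using that B_conv by (auto simp: X_def R_def bad_def relevant_edges_def sym)
      moreover have "?A \<inter> ?A\<inverse> = {}"
        using irrefl by (auto simp: relevant_edges_def)
      moreover have "(?A \<union> ?A\<inverse>) \<inter> {e \<in> R. bad B \<psi> e} = {}"
        by (auto simp: R_def)
      moreover have "finite ?A" "finite R"
        using fin \<open>finite X\<close> by (auto simp: R_def)
      ultimately show ?thesis
        by (simp add: m_def card_Un_disjoint)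
    qed
    have "{e \<in> R. bad B \<chi> e} = {e \<in> R. bad B (\<chi>(v := c)) e}"
      by (auto simp: R_def X_def relevant_edges_def bad_def sym)
    moreover have "m \<chi> \<le> m (\<chi>(v := c))"
      using \<chi> c(1) by auto
    ultimately have "card {e \<in> relevant_edges E v. bad B \<chi> e}
        \<le> card {e \<in> relevant_edges E v. bad B (\<chi>(v := c)) e}"
      using split by simp
    then show ?thesis
      using c(2) unfolding few_bad_edges_def by (meson le_trans mult_le_mono2)
  qed
  with \<chi>(1) show ?thesis
    by blast
qed

section \<open>Vertices of infinite degree, and the final colouring\<close>

lemma exists_deletion_serving_infinite_degrees:
  assumes "E \<subseteq> V \<times> V" "countable V" "digraph_system l V E L B"
  shows "\<exists>d. \<forall>v\<in>V. infinite (relevant_edges E v) \<longrightarrow> (\<forall>c\<in>L v.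
           infinite {u \<in> E `` {v}. \<forall>c'\<in>L u - {d u}. (c, c') \<notin> B v u})"
proof -
  \<comment> \<open>A request \<open>(v, c)\<close> asks that infinitely many neighbours of
    \<open>v\<close> lose their colour in conflict with \<open>c\<close>.\<close>
  define T where "T = (SIGMA v:{v \<in> V. infinite (relevant_edges E v)}. L v)"
  have "countable T"
    unfolding T_def using assms(2,3)
    by (intro countable_SIGMA) (auto simp: digraph_system_def intro: countable_finite)
  moreover have "infinite (E `` {fst t})" if "t \<in> T" for t
  proof -
    have "relevant_edges E (fst t) = Pair (fst t) ` (E `` {fst t})"
      by (auto simp: relevant_edges_def)
    then show ?thesis
      using that by (auto simp: T_def)
  qed
  \<comment> \<open>If some colour at \<open>u\<close> conflicts with \<open>c\<close>, it is unique
    and \<open>SOME\<close> picks it. Otherwise the choice is arbitrary, and no colour left at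
    \<open>u\<close> conflicts with \<open>c\<close> anyway.\<close>
  ultimately obtain d where
    d: "\<And>t. t \<in> T \<Longrightarrow> infinite {u \<in> E `` {fst t}. d u = (SOME c'. (snd t, c') \<in> B (fst t) u)}"
    using infinitely_often_prescribed_values[of T "\<lambda>t. E `` {fst t}"
        "\<lambda>t u. SOME c'. (snd t, c') \<in> B (fst t) u"] by blast
  have "infinite {u \<in> E `` {v}. \<forall>c'\<in>L u - {d u}. (c, c') \<notin> B v u}"
    if "v \<in> V" "infinite (relevant_edges E v)" "c \<in> L v" for v c
  proof -
    have "(v, c) \<in> T"
      using that by (simp add: T_def)
    then have "infinite {u \<in> E `` {v}. d u = (SOME c'. (c, c') \<in> B v u)}"
      using d by fastforce
    moreover have "{u \<in> E `` {v}. d u = (SOME c'. (c, c') \<in> B v u)}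
        \<subseteq> {u \<in> E `` {v}. \<forall>c'\<in>L u - {d u}. (c, c') \<notin> B v u}"
    proof clarsimp
      fix u c'
      assume u: "(v, u) \<in> E" "c' \<noteq> (SOME c'. (c, c') \<in> B v u)" "(c, c') \<in> B v u"
      have "correspondence (L v) (L u) (B v u)"
        using assms(3) u(1) by (auto simp: digraph_system_def)
      moreover have "(c, SOME c'. (c, c') \<in> B v u) \<in> B v u"
        using u(3) by (rule someI)
      ultimately show False
        using u(2,3) correspondence_right_unique by metis
    qed
    ultimately show ?thesis
      using finite_subset by blast
  qed
  then show ?thesis
    by blast
qed

text \<open>The common frame of both cases: graphs and acyclic digraphs differ only in how
  \<open>fin_sat\<close> is established. It is stated for arbitrary lists of at least
  \<open>k\<close> colours so that it applies after the deletion.\<close>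

lemma exists_majority_correspondence_colouring:
  fixes L :: "'v \<Rightarrow> 'c set"
  assumes "E \<subseteq> V \<times> V" "countable V" "digraph_system (k + 1) V E L B" "0 < k"
    and fin_sat: "\<And>(L' :: 'v \<Rightarrow> 'c set) F. (\<And>v. v \<in> V \<Longrightarrow> finite (L' v)) \<Longrightarrow>
      (\<And>v. v \<in> V \<Longrightarrow> k \<le> card (L' v)) \<Longrightarrow> finite F \<Longrightarrow>
      F \<subseteq> {v \<in> V. finite (relevant_edges E v)} \<Longrightarrow>
      \<exists>\<chi>. (\<forall>v\<in>V. \<chi> v \<in> L' v) \<and> (\<forall>v\<in>F. few_bad_edges k E B \<chi> v)"
  shows "\<exists>\<chi>. majority_correspondence_colouring k V E L B \<chi>"
proof -
  obtain d where d: "\<And>v c. v \<in> V \<Longrightarrow> infinite (relevant_edges E v) \<Longrightarrow> c \<in> L v \<Longrightarrow>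
      infinite {u \<in> E `` {v}. \<forall>c'\<in>L u - {d u}. (c, c') \<notin> B v u}"
    using exists_deletion_serving_infinite_degrees[OF assms(1-3)] by blast
  define L' where "L' v = L v - {d v}" for v
  let ?S = "{v \<in> V. finite (relevant_edges E v)}"
  have L: "finite (L v)" "card (L v) = k + 1" if "v \<in> V" for v
    using that assms(3) by (auto simp: digraph_system_def)
  have fin_L': "finite (L' v)" if "v \<in> V" for v
    using L that by (simp add: L'_def)
  \<comment> \<open>Only an inequality: \<open>d v\<close> need not belong to
    \<open>L v\<close>.\<close>
  have card_L': "k \<le> card (L' v)" if "v \<in> V" for v
    using L[OF that] by (simp add: L'_def card_Diff_singleton_if)
  have "\<exists>\<chi>. (\<forall>v\<in>V. \<chi> v \<in> L' v) \<and> (\<forall>v\<in>?S. few_bad_edges k E B \<chi> v)"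
  proof (rule countable_colouring_compactness[where D = "\<lambda>v. insert v (E `` {v})"])
    show "finite (insert v (E `` {v}))" if "v \<in> ?S" for v
    proof -
      have "E `` {v} = snd ` relevant_edges E v"
        by (force simp: relevant_edges_def)
      with that show ?thesis
        by simp
    qed
    show "few_bad_edges k E B \<chi>' v"
      if "\<And>u. u \<in> insert v (E `` {v}) \<Longrightarrow> \<chi> u = \<chi>' u" "few_bad_edges k E B \<chi> v" for v \<chi> \<chi>'
      using few_bad_edges_cong[of v E \<chi> \<chi>'] that by blast
    show "\<exists>\<chi>. (\<forall>v\<in>V. \<chi> v \<in> L' v) \<and> (\<forall>v\<in>F. few_bad_edges k E B \<chi> v)"
      if "finite F" "F \<subseteq> ?S" for F
      using fin_sat[OF fin_L' card_L' that] .
  qed (use assms(1,2) fin_L' in auto)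
  then obtain \<chi> where \<chi>: "\<And>v. v \<in> V \<Longrightarrow> \<chi> v \<in> L' v" "\<And>v. v \<in> ?S \<Longrightarrow> few_bad_edges k E B \<chi> v"
    by blast
  have "real (card {e \<in> relevant_edges E v. bad B \<chi> e})
      \<le> 1 / real k * real (card (relevant_edges E v))"
    if "v \<in> V" "finite (relevant_edges E v)" for v
  proof -
    have "real (k * card {e \<in> relevant_edges E v. bad B \<chi> e}) \<le> real (card (relevant_edges E v))"
      using \<chi>(2) that unfolding few_bad_edges_def of_nat_le_iff by blast
    then show ?thesis
      using \<open>0 < k\<close> by (simp add: field_simps)
  qed
  moreover have "infinite {e \<in> relevant_edges E v. \<not> bad B \<chi> e}"
    if "v \<in> V" "infinite (relevant_edges E v)" for v
  proof -
    let ?N = "{u \<in> E `` {v}. \<forall>c'\<in>L u - {d u}. (\<chi> v, c') \<notin> B v u}"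
    have "infinite (Pair v ` ?N)"
      using d[OF that, of "\<chi> v"] \<chi>(1)[OF that(1)]
      by (subst finite_image_iff) (auto simp: L'_def inj_on_def)
    \<comment> \<open>For \<open>u\<close> in \<open>?N\<close> the colour of \<open>u\<close>
      survives the deletion of \<open>d u\<close>, so it cannot conflict with the colour of
      \<open>v\<close>.\<close>
    moreover have "Pair v ` ?N \<subseteq> {e \<in> relevant_edges E v. \<not> bad B \<chi> e}"
      using \<chi>(1) assms(1) by (auto simp: relevant_edges_def bad_def L'_def)
    ultimately show ?thesis
      using finite_subset by blast
  qed
  moreover have "\<forall>v\<in>V. \<chi> v \<in> L v"
    using \<chi>(1) by (auto simp: L'_def)
  ultimately show ?thesis
    unfolding majority_correspondence_colouring_def by auto
qed

theorem theorem11: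
  fixes k :: nat
  assumes "k \<ge> 2"
  shows "(\<forall>(V :: 'v set) E. graph V E \<and> countable V \<longrightarrow>
            graph_majority_correspondence_colourable TYPE('c) k (k + 1) V E) \<and>
         (\<forall>(V :: 'v set) E. digraph V E \<and> acyclic E \<and> countable V \<longrightarrow>
            digraph_majority_correspondence_colourable TYPE('c) k (k + 1) V E)"
proof (intro conjI allI impI)
  have "0 < k"
    using assms by simp
  fix V :: "'v set" and E :: "'v rel"
  show "graph_majority_correspondence_colourable TYPE('c) k (k + 1) V E"
    if "graph V E \<and> countable V"
    unfolding graph_majority_correspondence_colourable_def
  proof (intro allI impI)
    fix L :: "'v \<Rightarrow> 'c set" and B
    assume sys: "graph_system (k + 1) V E L B"
    show "\<exists>\<chi>. majority_correspondence_colouring k V E L B \<chi>"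
    proof (rule exists_majority_correspondence_colouring)
      show "E \<subseteq> V \<times> V" "countable V" "digraph_system (k + 1) V E L B"
        using that sys by (auto simp: graph_def graph_system_def)
    qed (use \<open>0 < k\<close> graph_finitely_satisfiable[OF _ sys] that in blast)+
  qed
  show "digraph_majority_correspondence_colourable TYPE('c) k (k + 1) V E"
    if "digraph V E \<and> acyclic E \<and> countable V"
    unfolding digraph_majority_correspondence_colourable_def
  proof (intro allI impI)
    fix L :: "'v \<Rightarrow> 'c set" and B
    assume sys: "digraph_system (k + 1) V E L B"
    show "\<exists>\<chi>. majority_correspondence_colouring k V E L B \<chi>"
    proof (rule exists_majority_correspondence_colouring)
      show "E \<subseteq> V \<times> V" "countable V" "digraph_system (k + 1) V E L B"
        using that sys by (auto simp: digraph_def)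
    qed (use \<open>0 < k\<close> acyclic_digraph_finitely_satisfiable[OF sys] that in blast)+
  qed
qed

end
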